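(* Let $\Lambda$ be a proper $\Lambda$-sequence. Then $C\Lambda BV_c$ is the closure, in the space $(\Lambda BV,\|\cdot\|_\Lambda)$, of the space of polynomials (regarded as functions on $[0,1]$).
   Context: A $\Lambda$-sequence is a nondecreasing sequence $\Lambda=(\lambda_k)_{k\ge 1}$ of positive reals with $\sum_k \frac{1}{\lambda_k}=\infty$; it is proper if $\lambda_k\to\infty$. For a closed interval $I=[a,b]\subseteq[0,1]$ and $f:[0,1]\to\mathbb{R}$ write $|f(I)|=|f(b)-f(a)|$. Closed intervals are nonoverlapping if any two of them intersect at most at endpoints. For a finite sequence $\mathcal{I}=\langle I_1,\dots,I_m\rangle$ (in any order) of nonoverlapping closed intervals contained in $[0,1]$ put $\sigma_\Lambda(f,\mathcal{I})=\sum_{k=1}^m\frac{|f(I_k)|}{\lambda_k}$. The $\Lambda$-variation of $f$ is $V_\Lambda(f)=\sup_{\mathcal{I}}\sigma_\Lambda(f,\mathcal{I})\in[0,\infty]$, the supremum being over all such finite sequences. $\Lambda BV$ is the linear space of all $f:[0,1]\to\mathbb{R}$ with $V_\Lambda(f)<\infty$, normed by $\|f\|_\Lambda=V_\Lambda(f)+|f(0)|$. For $m\ge 1$, $\Lambda_{(m)}=(\lambda_{m+1},\lambda_{m+2},\dots)$. A function $f\in\Lambda BV$ is continuous in $\Lambda$-variation if $\lim_{m\to\infty}V_{\Lambda_{(m)}}(f)=0$. $C\Lambda BV_c$ is the set of all continuous functions $f:[0,1]\to\mathbb{R}$ that are continuous in $\Lambda$-variation. Polynomials have real coefficients. *)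

theory Defs
  imports "HOL-Analysis.Analysis" "HOL-Computational_Algebra.Polynomial"
begin

text \<open>Sequences are indexed from 0: the value \<open>\<Lambda> k\<close> is the \<open>(k+1)\<close>-st term
  of the sequence. As the terms are positive, divergence of the series of
  reciprocals to infinity is the same as non-summability.\<close>

definition Lambda_sequence :: "(nat \<Rightarrow> real) \<Rightarrow> bool" where
  "Lambda_sequence \<Lambda> \<longleftrightarrow>
     mono \<Lambda> \<and> (\<forall>k. 0 < \<Lambda> k) \<and> \<not> summable (\<lambda>k. 1 / \<Lambda> k)"

definition proper_Lambda_sequence :: "(nat \<Rightarrow> real) \<Rightarrow> bool" where
  "proper_Lambda_sequence \<Lambda> \<longleftrightarrow>
     Lambda_sequence \<Lambda> \<and> filterlim \<Lambda> at_top sequentially"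

definition shift_seq :: "nat \<Rightarrow> (nat \<Rightarrow> real) \<Rightarrow> nat \<Rightarrow> real" where
  "shift_seq m \<Lambda> = (\<lambda>k. \<Lambda> (k + m))"

text \<open>A pair \<open>(a, b)\<close> with \<open>a < b\<close> encodes the closed interval \<open>{a..b}\<close>. The order
  of the list is arbitrary. Admitting one-point intervals would not change the
  variation, since they contribute nothing and \<open>\<Lambda>\<close> is nondecreasing.\<close>

definition nonoverlapping :: "(real \<times> real) list \<Rightarrow> bool" where
  "nonoverlapping I \<longleftrightarrow>
     (\<forall>i < length I. \<forall>j < length I. i \<noteq> j \<longrightarrow>
        {fst (I ! i)..snd (I ! i)} \<inter> {fst (I ! j)..snd (I ! j)}
          \<subseteq> {fst (I ! i), snd (I ! i)} \<inter> {fst (I ! j), snd (I ! j)})"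

definition interval_seqs :: "(real \<times> real) list set" where
  "interval_seqs =
     {I. (\<forall>(a, b) \<in> set I. 0 \<le> a \<and> a < b \<and> b \<le> 1) \<and> nonoverlapping I}"

definition sigma_sum :: "(nat \<Rightarrow> real) \<Rightarrow> (real \<Rightarrow> real) \<Rightarrow> (real \<times> real) list \<Rightarrow> real" where
  "sigma_sum \<Lambda> f I = (\<Sum>k<length I. \<bar>f (snd (I ! k)) - f (fst (I ! k))\<bar> / \<Lambda> k)"

definition Lambda_variation :: "(nat \<Rightarrow> real) \<Rightarrow> (real \<Rightarrow> real) \<Rightarrow> ennreal" where
  "Lambda_variation \<Lambda> f = (SUP I \<in> interval_seqs. ennreal (sigma_sum \<Lambda> f I))"

text \<open>A function \<open>[0,1] \<rightarrow> \<real>\<close> is an element of \<open>extensional {0..1}\<close>, so that it is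
  determined by its values on \<open>[0,1]\<close>; the variation and the norm only look at those
  values.\<close>

definition LambdaBV :: "(nat \<Rightarrow> real) \<Rightarrow> (real \<Rightarrow> real) set" where
  "LambdaBV \<Lambda> = {f \<in> extensional {0..1}. Lambda_variation \<Lambda> f < \<infinity>}"

definition Lambda_norm :: "(nat \<Rightarrow> real) \<Rightarrow> (real \<Rightarrow> real) \<Rightarrow> real" where
  "Lambda_norm \<Lambda> f = enn2real (Lambda_variation \<Lambda> f) + \<bar>f 0\<bar>"

definition Lambda_dist :: "(nat \<Rightarrow> real) \<Rightarrow> (real \<Rightarrow> real) \<Rightarrow> (real \<Rightarrow> real) \<Rightarrow> real" where
  "Lambda_dist \<Lambda> f g = Lambda_norm \<Lambda> (\<lambda>x \<in> {0..1}. f x - g x)"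

definition LambdaBV_topology :: "(nat \<Rightarrow> real) \<Rightarrow> (real \<Rightarrow> real) topology" where
  "LambdaBV_topology \<Lambda> = Metric_space.mtopology (LambdaBV \<Lambda>) (Lambda_dist \<Lambda>)"

definition continuous_in_Lambda_variation :: "(nat \<Rightarrow> real) \<Rightarrow> (real \<Rightarrow> real) \<Rightarrow> bool" where
  "continuous_in_Lambda_variation \<Lambda> f \<longleftrightarrow>
     f \<in> LambdaBV \<Lambda> \<and> (\<lambda>m. Lambda_variation (shift_seq m \<Lambda>) f) \<longlonglongrightarrow> 0"

definition CLambdaBV_c :: "(nat \<Rightarrow> real) \<Rightarrow> (real \<Rightarrow> real) set" where
  "CLambdaBV_c \<Lambda> =
     {f \<in> extensional {0..1}. continuous_on {0..1} f \<and> continuous_in_Lambda_variation \<Lambda> f}"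

definition polynomial_functions :: "(real \<Rightarrow> real) set" where
  "polynomial_functions = range (\<lambda>p :: real poly. restrict (poly p) {0..1})"


text \<open>The distance is a metric on \<open>\<Lambda>BV\<close>, so \<open>LambdaBV_topology\<close> is the norm topology,
  and the polynomial functions belong to \<open>\<Lambda>BV\<close>.\<close>

lemma interval_seqs_nth:
  assumes "I \<in> interval_seqs" "k < length I"
  shows "0 \<le> fst (I ! k)" "fst (I ! k) < snd (I ! k)" "snd (I ! k) \<le> 1"
proof -
  have "I ! k \<in> set I" using assms by simp
  then show "0 \<le> fst (I ! k)" "fst (I ! k) < snd (I ! k)" "snd (I ! k) \<le> 1"
    using assms by (auto simp: interval_seqs_def split_beta)
qed

lemma sigma_sum_le_variation:
  "I \<in> interval_seqs \<Longrightarrow> ennreal (sigma_sum \<Lambda> f I) \<le> Lambda_variation \<Lambda> f"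
  unfolding Lambda_variation_def by (rule SUP_upper)

lemma Lambda_variation_cong:
  assumes "\<And>x. 0 \<le> x \<Longrightarrow> x \<le> 1 \<Longrightarrow> \<bar>f x - f' x\<bar> = 0"
  shows "Lambda_variation \<Lambda> f = Lambda_variation \<Lambda> f'"
proof -
  have "sigma_sum \<Lambda> f I = sigma_sum \<Lambda> f' I" if I: "I \<in> interval_seqs" for I
    unfolding sigma_sum_def
  proof (intro sum.cong refl)
    fix k assume "k \<in> {..<length I}"
    then have "0 \<le> fst (I ! k)" "fst (I ! k) < snd (I ! k)" "snd (I ! k) \<le> 1"
      using interval_seqs_nth[OF I] by auto
    then show "\<bar>f (snd (I ! k)) - f (fst (I ! k))\<bar> / \<Lambda> k =
        \<bar>f' (snd (I ! k)) - f' (fst (I ! k))\<bar> / \<Lambda> k"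
      using assms[of "fst (I ! k)"] assms[of "snd (I ! k)"] by simp
  qed
  then show ?thesis unfolding Lambda_variation_def by (intro SUP_cong) auto
qed

lemma Lambda_variation_add_le:
  assumes "\<forall>k. 0 < \<Lambda> k"
    and h: "\<And>x. 0 \<le> x \<Longrightarrow> x \<le> 1 \<Longrightarrow> h x = f x + g x"
  shows "Lambda_variation \<Lambda> h \<le> Lambda_variation \<Lambda> f + Lambda_variation \<Lambda> g"
  unfolding Lambda_variation_def[of \<Lambda> h]
proof (rule SUP_least)
  fix I assume I: "I \<in> interval_seqs"
  have nn: "0 \<le> sigma_sum \<Lambda> u I" for u
    unfolding sigma_sum_def using assms(1) by (intro sum_nonneg) (simp add: less_imp_le)
  have "sigma_sum \<Lambda> h I \<le> sigma_sum \<Lambda> f I + sigma_sum \<Lambda> g I"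
    unfolding sigma_sum_def sum.distrib[symmetric]
  proof (intro sum_mono)
    fix k assume "k \<in> {..<length I}"
    then have "0 \<le> fst (I ! k)" "fst (I ! k) < snd (I ! k)" "snd (I ! k) \<le> 1"
      using interval_seqs_nth[OF I] by auto
    then have "\<bar>h (snd (I ! k)) - h (fst (I ! k))\<bar> \<le>
        \<bar>f (snd (I ! k)) - f (fst (I ! k))\<bar> + \<bar>g (snd (I ! k)) - g (fst (I ! k))\<bar>"
      by (simp add: h)
    then show "\<bar>h (snd (I ! k)) - h (fst (I ! k))\<bar> / \<Lambda> k \<le>
        \<bar>f (snd (I ! k)) - f (fst (I ! k))\<bar> / \<Lambda> k + \<bar>g (snd (I ! k)) - g (fst (I ! k))\<bar> / \<Lambda> k"
      using assms(1) by (simp add: add_divide_distrib[symmetric] divide_right_mono less_imp_le)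
  qed
  then have "ennreal (sigma_sum \<Lambda> h I) \<le> ennreal (sigma_sum \<Lambda> f I) + ennreal (sigma_sum \<Lambda> g I)"
    by (simp add: ennreal_plus[symmetric] nn del: ennreal_plus)
  also have "\<dots> \<le> Lambda_variation \<Lambda> f + Lambda_variation \<Lambda> g"
    using I by (intro add_mono sigma_sum_le_variation)
  finally show "ennreal (sigma_sum \<Lambda> h I) \<le> Lambda_variation \<Lambda> f + Lambda_variation \<Lambda> g" .
qed

lemma Lambda_variation_uminus: "Lambda_variation \<Lambda> (\<lambda>x. - f x) = Lambda_variation \<Lambda> f"
  unfolding Lambda_variation_def sigma_sum_def by (simp add: abs_minus_commute)

lemma Lambda_dist_alt:
  "Lambda_dist \<Lambda> f g = enn2real (Lambda_variation \<Lambda> (\<lambda>x. f x - g x)) + \<bar>f 0 - g 0\<bar>"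
proof -
  have "Lambda_variation \<Lambda> (\<lambda>x \<in> {0..1}. f x - g x) = Lambda_variation \<Lambda> (\<lambda>x. f x - g x)"
    by (rule Lambda_variation_cong) simp
  then show ?thesis by (simp add: Lambda_dist_def Lambda_norm_def)
qed

lemma Lambda_variation_diff_finite:
  assumes "\<forall>k. 0 < \<Lambda> k" "f \<in> LambdaBV \<Lambda>" "g \<in> LambdaBV \<Lambda>"
  shows "Lambda_variation \<Lambda> (\<lambda>x. f x - g x) < \<infinity>"
proof -
  have "Lambda_variation \<Lambda> (\<lambda>x. f x - g x) \<le>
      Lambda_variation \<Lambda> f + Lambda_variation \<Lambda> (\<lambda>x. - g x)"
    using assms(1) by (rule Lambda_variation_add_le) simp
  also have "\<dots> < \<infinity>"
    using assms(2,3) by (simp add: Lambda_variation_uminus LambdaBV_def)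
  finally show ?thesis .
qed

lemma Lambda_variation_eq_0D:
  assumes "\<forall>k. 0 < \<Lambda> k" "Lambda_variation \<Lambda> f = 0" "0 \<le> x" "x \<le> 1"
  shows "f x = f 0"
proof (cases "x = 0")
  case False
  have "[(0, x)] \<in> interval_seqs"
    using assms False by (auto simp: interval_seqs_def nonoverlapping_def)
  from sigma_sum_le_variation[OF this, of \<Lambda> f] have "\<bar>f x - f 0\<bar> / \<Lambda> 0 \<le> 0"
    using assms(2) by (simp add: sigma_sum_def ennreal_eq_0_iff)
  then show ?thesis using assms(1)[rule_format, of 0] by (simp add: divide_le_0_iff)
qed simp

lemma Metric_space_LambdaBV:
  assumes "Lambda_sequence \<Lambda>"
  shows "Metric_space (LambdaBV \<Lambda>) (Lambda_dist \<Lambda>)"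
proof
  have pos: "\<forall>k. 0 < \<Lambda> k" using assms by (simp add: Lambda_sequence_def)
  fix f g h
  show "0 \<le> Lambda_dist \<Lambda> f g" by (simp add: Lambda_dist_alt)
  show "Lambda_dist \<Lambda> f g = Lambda_dist \<Lambda> g f"
    using Lambda_variation_uminus[of \<Lambda> "\<lambda>x. f x - g x"]
    by (simp add: Lambda_dist_alt abs_minus_commute)
  assume f: "f \<in> LambdaBV \<Lambda>" and g: "g \<in> LambdaBV \<Lambda>"
  note fin = Lambda_variation_diff_finite[OF pos]
  show "Lambda_dist \<Lambda> f g = 0 \<longleftrightarrow> f = g"
  proof
    assume "Lambda_dist \<Lambda> f g = 0"
    then have *: "enn2real (Lambda_variation \<Lambda> (\<lambda>x. f x - g x)) = 0" "f 0 = g 0"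
      unfolding Lambda_dist_alt by (auto simp: add_nonneg_eq_0_iff)
    then have "Lambda_variation \<Lambda> (\<lambda>x. f x - g x) = 0"
      using fin[OF f g] by (auto simp: enn2real_eq_0_iff)
    from Lambda_variation_eq_0D[OF pos this] *(2) have "f x = g x" if "0 \<le> x" "x \<le> 1" for x
      using that by simp
    then show "f = g"
      using f g by (intro extensionalityI[of f "{0..1}"]) (auto simp: LambdaBV_def)
  next
    assume "f = g"
    then show "Lambda_dist \<Lambda> f g = 0"
      by (simp add: Lambda_dist_alt Lambda_variation_def sigma_sum_def SUP_constant bot_ennreal)
  qed
  assume h: "h \<in> LambdaBV \<Lambda>"
  have "Lambda_variation \<Lambda> (\<lambda>x. f x - h x) \<le>
      Lambda_variation \<Lambda> (\<lambda>x. f x - g x) + Lambda_variation \<Lambda> (\<lambda>x. g x - h x)"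
    using pos by (rule Lambda_variation_add_le) simp
  then have "enn2real (Lambda_variation \<Lambda> (\<lambda>x. f x - h x)) \<le>
      enn2real (Lambda_variation \<Lambda> (\<lambda>x. f x - g x) + Lambda_variation \<Lambda> (\<lambda>x. g x - h x))"
    using fin[OF f g] fin[OF g h] by (intro enn2real_mono) auto
  also have "\<dots> = enn2real (Lambda_variation \<Lambda> (\<lambda>x. f x - g x)) +
      enn2real (Lambda_variation \<Lambda> (\<lambda>x. g x - h x))"
    using fin[OF f g] fin[OF g h] by (intro enn2real_plus) auto
  finally show "Lambda_dist \<Lambda> f h \<le> Lambda_dist \<Lambda> f g + Lambda_dist \<Lambda> g h"
    by (simp add: Lambda_dist_alt)
qed

lemma topspace_LambdaBV_topology:
  "Lambda_sequence \<Lambda> \<Longrightarrow> topspace (LambdaBV_topology \<Lambda>) = LambdaBV \<Lambda>"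
  unfolding LambdaBV_topology_def
  by (rule Metric_space.topspace_mtopology[OF Metric_space_LambdaBV])

lemma sum_lengths_le_1:
  assumes I: "I \<in> interval_seqs"
  shows "(\<Sum>k<length I. snd (I ! k) - fst (I ! k)) \<le> 1"
proof -
  define A where "A k = {fst (I ! k)<..<snd (I ! k)}" for k
  have "disjoint_family_on A {..<length I}"
    unfolding disjoint_family_on_def
  proof (intro ballI impI)
    fix i j assume ij: "i \<in> {..<length I}" "j \<in> {..<length I}" "i \<noteq> j"
    then have "{fst (I ! i)..snd (I ! i)} \<inter> {fst (I ! j)..snd (I ! j)}
        \<subseteq> {fst (I ! i), snd (I ! i)}"
      using I by (auto simp: interval_seqs_def nonoverlapping_def)
    then have "x \<in> {fst (I ! i), snd (I ! i)}" if "x \<in> A i" "x \<in> A j" for x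
      using that unfolding A_def by (intro subsetD[of _ "{fst (I ! i), snd (I ! i)}"]) auto
    then show "A i \<inter> A j = {}" unfolding A_def by fastforce
  qed
  moreover have "emeasure lborel (A k) \<noteq> \<infinity>" if "k < length I" for k
    using interval_seqs_nth[OF I that] by (simp add: A_def)
  moreover have "A ` {..<length I} \<subseteq> sets lborel" by (auto simp: A_def)
  ultimately have "measure lborel (\<Union>k<length I. A k) = (\<Sum>k<length I. measure lborel (A k))"
    by (intro measure_finite_Union) auto
  also have "\<dots> = (\<Sum>k<length I. snd (I ! k) - fst (I ! k))"
    using interval_seqs_nth[OF I] by (intro sum.cong) (auto simp: A_def less_imp_le)
  finally have "(\<Sum>k<length I. snd (I ! k) - fst (I ! k)) = measure lborel (\<Union>k<length I. A k)" ..
  also have "\<dots> \<le> measure lborel {0..1::real}"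
  proof (rule measure_mono_fmeasurable)
    show "(\<Union>k<length I. A k) \<subseteq> {0..1}"
    proof (intro UN_least subsetI)
      fix k x assume "k \<in> {..<length I}" "x \<in> A k"
      then show "x \<in> {0..1}"
        using interval_seqs_nth[OF I, of k] by (simp add: A_def)
    qed
  qed (auto simp: A_def fmeasurable_def)
  finally show ?thesis by simp
qed

lemma polynomial_functions_subset_LambdaBV:
  assumes "Lambda_sequence \<Lambda>"
  shows "polynomial_functions \<subseteq> LambdaBV \<Lambda>"
proof
  fix f assume "f \<in> polynomial_functions"
  then obtain p :: "real poly" where f: "f = restrict (poly p) {0..1}"
    by (auto simp: polynomial_functions_def)
  have pos: "0 < \<Lambda> k" and le: "\<Lambda> 0 \<le> \<Lambda> k" for k
    using assms by (auto simp: Lambda_sequence_def mono_def)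
  have "compact (poly (pderiv p) ` {0..1})"
    by (intro compact_continuous_image continuous_intros) auto
  then have "bounded (poly (pderiv p) ` {0..1})" by (rule compact_imp_bounded)
  then obtain B where "0 < B" "\<forall>x\<in>{0..1}. \<bar>poly (pderiv p) x\<bar> \<le> B"
    unfolding bounded_pos by auto
  then have B: "\<And>x. 0 \<le> x \<Longrightarrow> x \<le> 1 \<Longrightarrow> \<bar>poly (pderiv p) x\<bar> \<le> B" "0 < B"
    by auto
  have lip: "\<bar>poly p b - poly p a\<bar> \<le> B * (b - a)" if "0 \<le> a" "a < b" "b \<le> 1" for a b
  proof -
    obtain x where "a < x" "x < b" "poly p b - poly p a = (b - a) * poly (pderiv p) x"
      using poly_MVT[OF \<open>a < b\<close>] by blast
    then show ?thesis
      using B(1)[of x] that by (simp add: abs_mult mult.commute mult_right_mono)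
  qed
  have "sigma_sum \<Lambda> f I \<le> B / \<Lambda> 0" if I: "I \<in> interval_seqs" for I
  proof -
    have "sigma_sum \<Lambda> f I \<le> (\<Sum>k<length I. B * (snd (I ! k) - fst (I ! k)) / \<Lambda> 0)"
      unfolding sigma_sum_def
    proof (intro sum_mono frac_le)
      fix k assume "k \<in> {..<length I}"
      then have "0 \<le> fst (I ! k)" "fst (I ! k) < snd (I ! k)" "snd (I ! k) \<le> 1"
        using interval_seqs_nth[OF I] by auto
      then show "\<bar>f (snd (I ! k)) - f (fst (I ! k))\<bar> \<le> B * (snd (I ! k) - fst (I ! k))"
        and "0 \<le> B * (snd (I ! k) - fst (I ! k))"
        using lip B(2) by (simp_all add: f)
    qed (use pos le in auto)
    also have "\<dots> = B / \<Lambda> 0 * (\<Sum>k<length I. snd (I ! k) - fst (I ! k))"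
      by (simp add: sum_distrib_left)
    also have "\<dots> \<le> B / \<Lambda> 0"
      using sum_lengths_le_1[OF I] B(2) pos[of 0] by (intro mult_left_le) auto
    finally show ?thesis .
  qed
  then have "Lambda_variation \<Lambda> f \<le> ennreal (B / \<Lambda> 0)"
    unfolding Lambda_variation_def by (intro SUP_least ennreal_leI)
  also have "\<dots> < \<infinity>" by simp
  finally show "f \<in> LambdaBV \<Lambda>" by (simp add: LambdaBV_def f)
qed

end

theory Submission
  imports Defs
begin

text \<open>
  The Bernstein polynomials \<open>B\<^sub>n f\<close> of a function \<open>f\<close> in \<open>C\<Lambda>BV\<^sub>c\<close> converge to \<open>f\<close> in
  \<open>\<Lambda>\<close>-norm. Uniform convergence is the theorem of Weierstrass. What
  turns it into convergence in variation is that \<open>B\<^sub>n\<close> does not increase any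
  \<open>\<Gamma>\<close>-variation (\<open>Lambda_variation_Bernstein_le\<close>). To see this, let \<open>U\<^sub>1, \<dots>, U\<^sub>n\<close> be
  independent and uniform on \<open>[0,1]\<close> and let \<open>\<phi>(x)\<close> be the proportion of those
  with \<open>U\<^sub>i \<le> x\<close>. Then \<open>B\<^sub>n f(x)\<close> is the expectation of \<open>f(\<phi>(x))\<close>, for all \<open>x\<close>
  on the same probability space, and \<open>\<phi>\<close> is a random monotone map. Therefore a
  \<open>\<Gamma>\<close>-sum of \<open>B\<^sub>n f\<close> is at most the expectation of the \<open>\<Gamma>\<close>-sum of \<open>f \<circ> \<phi>\<close> over the
  same intervals; as \<open>\<phi>\<close> carries nonoverlapping intervals to nonoverlapping intervals,
  some of them possibly single points, this is at most the \<open>\<Gamma>\<close>-variation of \<open>f\<close>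
  (\<open>sigma_sum_comp_mono_le\<close>).

  Applied to the tails \<open>\<Gamma> = \<Lambda>\<^bsub>(m)\<^esub>\<close>, this bounds the tail variation of \<open>f - B\<^sub>n f\<close> by twice
  that of \<open>f\<close>, uniformly in \<open>n\<close>. Given an accuracy, one picks \<open>m\<close> so that the tail variation
  is small, and then \<open>n\<close> so that \<open>f - B\<^sub>n f\<close> is uniformly small, which controls the
  first \<open>m\<close> terms of every \<open>\<Lambda>\<close>-sum (\<open>Lambda_variation_le_split\<close>).

  Conversely, both conditions that define \<open>C\<Lambda>BV\<^sub>c\<close> pass to limits: the norm dominates
  the supremum norm up to a constant, so limits of polynomials are continuous, and it
  dominates every tail variation. A polynomial has finite total variation \<open>W\<close>, hence tail
  variation at most \<open>W / \<lambda>\<^bsub>m+1\<^esub>\<close>, which tends to \<open>0\<close> precisely because \<open>\<Lambda>\<close> is proper.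
\<close>

section \<open>Lists of nonoverlapping intervals\<close>

text \<open>For nondegenerate intervals, meeting at most at endpoints amounts to one lying to the left of
  the other. In this form the condition is plainly inherited by sublists and by
  monotone images.\<close>

lemma interval_seqs_iff:
  "I \<in> interval_seqs \<longleftrightarrow> (\<forall>(a, b) \<in> set I. 0 \<le> a \<and> a < b \<and> b \<le> 1) \<and>
     sorted_wrt (\<lambda>p q. snd p \<le> fst q \<or> snd q \<le> fst p) I"
proof -
  have meet: "{a..b} \<inter> {c..d} \<subseteq> {a, b} \<inter> {c, d} \<longleftrightarrow> b \<le> c \<or> d \<le> a"
    if "a < b" "c < d" for a b c d :: real
  proof
    assume sub: "{a..b} \<inter> {c..d} \<subseteq> {a, b} \<inter> {c, d}"
    show "b \<le> c \<or> d \<le> a"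
    proof (rule ccontr)
      assume "\<not> (b \<le> c \<or> d \<le> a)"
      then have "max a c < min b d" using that by auto
      then obtain x where "max a c < x" "x < min b d" using dense by blast
      then show False using subsetD[OF sub, of x] by auto
    qed
  qed (use that in auto)
  show ?thesis
  proof (cases "\<forall>(a, b) \<in> set I. 0 \<le> a \<and> a < b \<and> b \<le> 1")
    case True
    then have lt: "fst (I ! i) < snd (I ! i)" if "i < length I" for i
      using that nth_mem[OF that] by (auto simp: split_beta)
    define R where
      "R i j \<longleftrightarrow> snd (I ! i) \<le> fst (I ! j) \<or> snd (I ! j) \<le> fst (I ! i)" for i j
    have "({fst (I ! i)..snd (I ! i)} \<inter> {fst (I ! j)..snd (I ! j)}
        \<subseteq> {fst (I ! i), snd (I ! i)} \<inter> {fst (I ! j), snd (I ! j)}) = R i j"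
      if "i < length I" "j < length I" for i j
      unfolding R_def by (rule meet[OF lt[OF that(1)] lt[OF that(2)]])
    then have "nonoverlapping I \<longleftrightarrow> (\<forall>i<length I. \<forall>j<length I. i \<noteq> j \<longrightarrow> R i j)"
      unfolding nonoverlapping_def by blast
    also have "\<dots> \<longleftrightarrow> (\<forall>i j. i < j \<longrightarrow> j < length I \<longrightarrow> R i j)"
    proof
      assume *: "\<forall>i j. i < j \<longrightarrow> j < length I \<longrightarrow> R i j"
      have "R i j" if "i < length I" "j < length I" "i \<noteq> j" for i j
        using *[rule_format, of i j] *[rule_format, of j i] that
        by (cases "i < j") (auto simp: R_def)
      then show "\<forall>i<length I. \<forall>j<length I. i \<noteq> j \<longrightarrow> R i j" by blast
    qed auto
    finally show ?thesis
      using True by (simp add: interval_seqs_def sorted_wrt_iff_nth_less R_def)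
  qed (auto simp: interval_seqs_def)
qed

lemma drop_interval_seqs: "I \<in> interval_seqs \<Longrightarrow> drop m I \<in> interval_seqs"
  unfolding interval_seqs_iff using set_drop_subset[of m I] sorted_wrt_drop by blast

text \<open>Dropping entries moves the later ones forward, where the weights \<open>1 / \<Lambda> k\<close> are
  at least as large; so dropping intervals on which \<open>f\<close> has no increment cannot decrease the sum.\<close>

lemma sigma_sum_filter:
  assumes "mono \<Lambda>" and pos: "\<And>k. 0 < \<Lambda> k"
    and zero: "\<And>p. p \<in> set I \<Longrightarrow> \<not> P p \<Longrightarrow> f (snd p) = f (fst p)"
  shows "sigma_sum \<Lambda> f I \<le> sigma_sum \<Lambda> f (filter P I)"
  using zero
proof (induction I rule: rev_induct)
  case (snoc p I)
  have snoc_sum: "sigma_sum \<Lambda> f (J @ [p]) =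
      sigma_sum \<Lambda> f J + \<bar>f (snd p) - f (fst p)\<bar> / \<Lambda> (length J)" for J
    by (simp add: sigma_sum_def nth_append)
  have "\<Lambda> (length (filter P I)) \<le> \<Lambda> (length I)"
    by (intro monoD[OF assms(1)]) simp
  then have "\<bar>f (snd p) - f (fst p)\<bar> / \<Lambda> (length I) \<le>
      \<bar>f (snd p) - f (fst p)\<bar> / \<Lambda> (length (filter P I))"
    using pos by (intro divide_left_mono) (auto intro: mult_pos_pos)
  with snoc show ?case by (cases "P p") (auto simp: snoc_sum)
qed simp

text \<open>The \<open>\<phi>\<close>-images of the intervals are again nonoverlapping, but some may collapse to
  points. These carry no increment of \<open>f\<close> and are filtered out.\<close>

lemma sigma_sum_comp_mono_le:
  assumes "mono \<Lambda>" and "\<And>k. 0 < \<Lambda> k" and I: "I \<in> interval_seqs"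
    and \<phi>: "mono_on {0..1} \<phi>" "\<phi> \<in> {0..1} \<rightarrow> {0..1}"
  shows "ennreal (sigma_sum \<Lambda> (f \<circ> \<phi>) I) \<le> Lambda_variation \<Lambda> f"
proof -
  define J where "J = map (map_prod \<phi> \<phi>) I"
  define K where "K = filter (\<lambda>p. fst p < snd p) J"
  have bounds: "0 \<le> fst p" "fst p < snd p" "snd p \<le> 1" if "p \<in> set I" for p
    using I that by (auto simp: interval_seqs_def split_beta)
  have le: "\<phi> x \<le> \<phi> y" if "0 \<le> x" "x \<le> y" "y \<le> 1" for x y
    using \<phi>(1) that by (auto simp: mono_on_def)
  have J: "0 \<le> fst p" "fst p \<le> snd p" "snd p \<le> 1" if p: "p \<in> set J" for p
  proof -
    obtain q where q: "p = map_prod \<phi> \<phi> q" "q \<in> set I"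
      using p unfolding J_def set_map by (rule imageE)
    have "\<phi> (fst q) \<in> {0..1}" "\<phi> (snd q) \<in> {0..1}"
      using bounds[OF q(2)] by (intro funcset_mem[OF \<phi>(2)]; simp)+
    then show "0 \<le> fst p" "fst p \<le> snd p" "snd p \<le> 1"
      using q(1) bounds[OF q(2)] by (auto intro: le)
  qed
  have sep: "sorted_wrt (\<lambda>p q. snd p \<le> fst q \<or> snd q \<le> fst p) I"
    using I by (simp add: interval_seqs_iff)
  have "sorted_wrt (\<lambda>p q. snd p \<le> fst q \<or> snd q \<le> fst p) J"
    unfolding J_def sorted_wrt_map
  proof (rule sorted_wrt_mono_rel[OF _ sep])
    fix p q assume "p \<in> set I" "q \<in> set I" "snd p \<le> fst q \<or> snd q \<le> fst p"
    then show "snd (map_prod \<phi> \<phi> p) \<le> fst (map_prod \<phi> \<phi> q) \<or>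
        snd (map_prod \<phi> \<phi> q) \<le> fst (map_prod \<phi> \<phi> p)"
      using bounds[of p] bounds[of q] le[of "snd p" "fst q"] le[of "snd q" "fst p"] by auto
  qed
  then have "sorted_wrt (\<lambda>p q. snd p \<le> fst q \<or> snd q \<le> fst p) K"
    unfolding K_def by (rule sorted_wrt_filter)
  moreover have "\<forall>(a, b) \<in> set K. 0 \<le> a \<and> a < b \<and> b \<le> 1"
    using J by (auto simp: K_def)
  ultimately have K: "K \<in> interval_seqs" by (simp add: interval_seqs_iff)
  have "sigma_sum \<Lambda> (f \<circ> \<phi>) I = sigma_sum \<Lambda> f J"
    by (simp add: sigma_sum_def J_def)
  also have "\<dots> \<le> sigma_sum \<Lambda> f K"
    unfolding K_def using assms(1,2)
    by (rule sigma_sum_filter) (metis J(2) order.order_iff_strict)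
  finally show ?thesis
    using sigma_sum_le_variation[OF K, of \<Lambda> f] by (meson ennreal_leI order_trans)
qed

section \<open>Bernstein polynomials do not increase the variation\<close>

text \<open>Conditioning on the last of \<open>Suc n\<close> independent trials with success probability \<open>x\<close>;
  algebraically this is Pascal's rule.\<close>

lemma Bernstein_sum_Suc:
  "(\<Sum>j\<le>Suc n. Bernstein (Suc n) j x * g j) =
     x * (\<Sum>j\<le>n. Bernstein n j x * g (Suc j)) + (1 - x) * (\<Sum>j\<le>n. Bernstein n j x * g j)"
proof -
  have pascal: "Bernstein (Suc n) (Suc j) x = x * Bernstein n j x + (1 - x) * Bernstein n (Suc j) x"
    if "j \<le> n" for j
  proof (cases "j = n")
    case False
    then have "n - j = Suc (n - Suc j)" using that by simp
    then show ?thesis by (simp add: Bernstein_def algebra_simps)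
  qed (simp add: Bernstein_def)
  have "(\<Sum>j\<le>n. Bernstein n (Suc j) x * g (Suc j)) + Bernstein n 0 x * g 0 =
      (\<Sum>j\<le>Suc n. Bernstein n j x * g j)"
    by (subst sum.atMost_Suc_shift) simp
  also have "\<dots> = (\<Sum>j\<le>n. Bernstein n j x * g j)"
    by (simp add: Bernstein_def)
  finally have top: "(\<Sum>j\<le>n. Bernstein n j x * g j) =
      (\<Sum>j\<le>n. Bernstein n (Suc j) x * g (Suc j)) + Bernstein n 0 x * g 0" ..
  have "(\<Sum>j\<le>Suc n. Bernstein (Suc n) j x * g j) = (1 - x) * Bernstein n 0 x * g 0 +
      (\<Sum>j\<le>n. (x * Bernstein n j x + (1 - x) * Bernstein n (Suc j) x) * g (Suc j))"
    by (subst sum.atMost_Suc_shift) (simp add: pascal, simp add: Bernstein_def)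
  also have "\<dots> = x * (\<Sum>j\<le>n. Bernstein n j x * g (Suc j)) +
      (1 - x) * ((\<Sum>j\<le>n. Bernstein n (Suc j) x * g (Suc j)) + Bernstein n 0 x * g 0)"
    by (simp add: algebra_simps sum.distrib sum_distrib_left sum_subtractf)
  finally show ?thesis by (simp only: top)
qed

lemma has_integral_step:
  fixes p q x :: real
  assumes "x \<in> {0..1}"
  shows "((\<lambda>u. if u \<le> x then p else q) has_integral (x * p + (1 - x) * q)) {0..1}"
proof (rule has_integral_combine[of 0 x 1])
  have "((\<lambda>u. p) has_integral x * p) {0..x}"
    using has_integral_const_real[of p 0 x] assms by simp
  then show "((\<lambda>u. if u \<le> x then p else q) has_integral x * p) {0..x}"
    by (rule has_integral_eq[rotated]) simp
  have "((\<lambda>u. q) has_integral (1 - x) * q) {x..1}"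
    using has_integral_const_real[of q x 1] assms by simp
  then show "((\<lambda>u. if u \<le> x then p else q) has_integral (1 - x) * q) {x..1}"
    by (rule has_integral_spike_finite[of "{x}", rotated 2]) auto
qed (use assms in auto)

text \<open>
  A weighted sum of increments that is bounded by \<open>M\<close> for all \<open>f \<circ> \<phi>\<close> with \<open>\<phi>\<close> monotone is
  bounded by \<open>M\<close> for the average of \<open>f\<close> over a binomially distributed number of steps of
  length \<open>h\<close>. Rather than working on a product space, the uniform variables of the
  coupling are integrated out one at a time: each turns the monotone starting point \<open>d\<close>
  into \<open>\<lambda>x. d x + (if u \<le> x then h else 0)\<close>, which is again monotone. A general \<open>d\<close> is needed
  for this induction; the Bernstein polynomial itself is the case \<open>d = 0\<close>, \<open>h = 1 / n\<close>.
\<close>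

lemma Bernstein_coupling:
  fixes f :: "real \<Rightarrow> real" and a b c :: "'i \<Rightarrow> real"
  assumes K: "finite K" "\<And>k. k \<in> K \<Longrightarrow> 0 \<le> c k"
      "\<And>k. k \<in> K \<Longrightarrow> a k \<in> {0..1}" "\<And>k. k \<in> K \<Longrightarrow> b k \<in> {0..1}"
    and bound: "\<And>\<phi>. mono_on {0..1} \<phi> \<Longrightarrow> \<phi> \<in> {0..1} \<rightarrow> {0..1} \<Longrightarrow>
      (\<Sum>k\<in>K. c k * \<bar>f (\<phi> (b k)) - f (\<phi> (a k))\<bar>) \<le> M"
    and h: "0 \<le> h"
    and d: "mono_on {0..1} d" "\<And>x. x \<in> {0..1} \<Longrightarrow> 0 \<le> d x \<and> d x + real n * h \<le> 1"
  shows "(\<Sum>k\<in>K. c k * \<bar>(\<Sum>j\<le>n. Bernstein n j (b k) * f (d (b k) + real j * h)) -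
      (\<Sum>j\<le>n. Bernstein n j (a k) * f (d (a k) + real j * h))\<bar>) \<le> M"
  using d
proof (induction n arbitrary: d)
  case 0
  then have "d \<in> {0..1} \<rightarrow> {0..1}" by auto
  then show ?case using bound[OF "0.prems"(1)] by (simp add: Bernstein_def)
next
  case (Suc n)
  define S where "S n d x = (\<Sum>j\<le>n. Bernstein n j x * f (d x + real j * h))" for n x and d :: "real \<Rightarrow> real"
  define e where "e u = (\<lambda>x. d x + (if u \<le> x then h else 0))" for u :: real
  have e: "(\<Sum>k\<in>K. c k * \<bar>S n (e u) (b k) - S n (e u) (a k)\<bar>) \<le> M" for u
    unfolding S_def
  proof (rule Suc.IH)
    show "mono_on {0..1} (e u)"
      using Suc.prems(1) h by (force simp: mono_on_def e_def intro: add_mono)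
    show "0 \<le> e u x \<and> e u x + real n * h \<le> 1" if "x \<in> {0..1}" for x
      using Suc.prems(2)[OF that] h by (auto simp: e_def algebra_simps)
  qed
  have S_Suc: "((\<lambda>u. S n (e u) x) has_integral S (Suc n) d x) {0..1}" if "x \<in> {0..1}" for x
  proof -
    have "S n (e u) x = (if u \<le> x then S n (\<lambda>x. d x + h) x else S n d x)" for u
      by (simp add: S_def e_def)
    moreover have "S (Suc n) d x = x * S n (\<lambda>x. d x + h) x + (1 - x) * S n d x"
      unfolding S_def by (subst Bernstein_sum_Suc) (simp add: algebra_simps)
    ultimately show ?thesis using has_integral_step[OF that] by presburger
  qed
  \<comment> \<open>Fixing the signs of the increments makes the left-hand side linear in \<open>S\<close>, so that
    integrating over \<open>u\<close> raises no question about the integrability of absolute values.\<close>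
  define s where "s k = sgn (S (Suc n) d (b k) - S (Suc n) d (a k))" for k
  have "((\<lambda>u. \<Sum>k\<in>K. c k * s k * (S n (e u) (b k) - S n (e u) (a k))) has_integral
      (\<Sum>k\<in>K. c k * s k * (S (Suc n) d (b k) - S (Suc n) d (a k)))) {0..1}"
    using K by (intro has_integral_sum has_integral_mult_right has_integral_diff S_Suc) auto
  moreover have "((\<lambda>u. M) has_integral M) {0..1::real}"
    using has_integral_const_real[of M 0 1] by simp
  moreover have "(\<Sum>k\<in>K. c k * s k * (S n (e u) (b k) - S n (e u) (a k))) \<le> M" for u
  proof -
    have "c k * s k * (S n (e u) (b k) - S n (e u) (a k)) \<le>
        c k * \<bar>S n (e u) (b k) - S n (e u) (a k)\<bar>" if "k \<in> K" for k
      using K(2)[OF that] unfolding mult.assoc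
      by (intro mult_left_mono) (auto simp: s_def sgn_real_def)
    then show ?thesis using e[of u] by (meson order_trans sum_mono)
  qed
  ultimately have "(\<Sum>k\<in>K. c k * s k * (S (Suc n) d (b k) - S (Suc n) d (a k))) \<le> M"
    by (rule has_integral_le)
  also have "(\<Sum>k\<in>K. c k * s k * (S (Suc n) d (b k) - S (Suc n) d (a k))) =
      (\<Sum>k\<in>K. c k * \<bar>S (Suc n) d (b k) - S (Suc n) d (a k)\<bar>)"
    by (intro sum.cong refl) (simp add: s_def abs_sgn mult.assoc mult.commute)
  finally show ?case by (simp only: S_def)
qed

definition Bernstein_approx :: "nat \<Rightarrow> (real \<Rightarrow> real) \<Rightarrow> real \<Rightarrow> real" where
  "Bernstein_approx n f x = (\<Sum>j\<le>n. f (real j / real n) * Bernstein n j x)"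

lemma Bernstein_approx_polynomial:
  "restrict (Bernstein_approx n f) {0..1} \<in> polynomial_functions"
proof -
  define p where "p = (\<Sum>j\<le>n. smult (f (real j / real n) * real (n choose j))
    ([:0, 1:] ^ j * [:1, -1:] ^ (n - j)))"
  have "poly p = Bernstein_approx n f"
    by (rule ext) (simp add: p_def Bernstein_approx_def Bernstein_def poly_sum mult.assoc)
  then show ?thesis by (metis polynomial_functions_def rangeI)
qed

lemma Lambda_variation_Bernstein_le:
  assumes "mono \<Lambda>" and pos: "\<And>k. 0 < \<Lambda> k" and "0 < n"
  shows "Lambda_variation \<Lambda> (Bernstein_approx n f) \<le> Lambda_variation \<Lambda> f"
proof (cases "Lambda_variation \<Lambda> f")
  case (real V)
  show ?thesis
    unfolding Lambda_variation_def[of _ "Bernstein_approx n f"]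
  proof (rule SUP_least)
    fix I assume I: "I \<in> interval_seqs"
    have in01: "fst (I ! k) \<in> {0..1}" "snd (I ! k) \<in> {0..1}" if "k < length I" for k
      using interval_seqs_nth[OF I that] by auto
    have "(\<Sum>k<length I. 1 / \<Lambda> k * \<bar>f (\<phi> (snd (I ! k))) - f (\<phi> (fst (I ! k)))\<bar>) \<le> V"
      if "mono_on {0..1} \<phi>" "\<phi> \<in> {0..1} \<rightarrow> {0..1}" for \<phi>
      using sigma_sum_comp_mono_le[OF assms(1,2) I that, of f] real
      by (simp add: sigma_sum_def)
    then have "(\<Sum>k<length I. 1 / \<Lambda> k *
        \<bar>(\<Sum>j\<le>n. Bernstein n j (snd (I ! k)) * f (0 + real j * (1 / real n))) -
         (\<Sum>j\<le>n. Bernstein n j (fst (I ! k)) * f (0 + real j * (1 / real n)))\<bar>) \<le> V"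
      using in01 pos \<open>0 < n\<close>
      by (intro Bernstein_coupling[where d = "\<lambda>_. 0"]) (auto simp: less_imp_le mono_on_def)
    then have "sigma_sum \<Lambda> (Bernstein_approx n f) I \<le> V"
      by (simp add: sigma_sum_def Bernstein_approx_def mult.commute)
    then show "ennreal (sigma_sum \<Lambda> (Bernstein_approx n f) I) \<le> Lambda_variation \<Lambda> f"
      using real by (simp add: ennreal_leI)
  qed
qed simp

section \<open>Tails of the variation and the supremum norm\<close>

lemma Lambda_variation_antimono:
  assumes "\<And>k. 0 < \<Lambda> k" "\<And>k. \<Lambda> k \<le> \<Gamma> k"
  shows "Lambda_variation \<Gamma> f \<le> Lambda_variation \<Lambda> f"
  unfolding Lambda_variation_def sigma_sum_def
  by (intro SUP_mono' ennreal_leI sum_mono divide_left_mono mult_pos_pos)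
    (auto intro: assms less_le_trans)

text \<open>Each of the first \<open>m\<close> terms of a \<open>\<Lambda>\<close>-sum is at most \<open>2 * \<delta> / \<Lambda> 0\<close>, and the remaining terms
  form a \<open>\<Lambda>\<^bsub>(m)\<^esub>\<close>-sum.\<close>

lemma Lambda_variation_le_split:
  assumes "mono \<Lambda>" and pos: "\<And>k. 0 < \<Lambda> k"
    and small: "\<And>x. x \<in> {0..1} \<Longrightarrow> \<bar>g x\<bar> \<le> \<delta>"
  shows "Lambda_variation \<Lambda> g \<le>
    ennreal (2 * real m * \<delta> / \<Lambda> 0) + Lambda_variation (shift_seq m \<Lambda>) g"
  unfolding Lambda_variation_def[of \<Lambda>]
proof (rule SUP_least)
  fix I assume I: "I \<in> interval_seqs"
  define t where "t k = \<bar>g (snd (I ! k)) - g (fst (I ! k))\<bar> / \<Lambda> k" for k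
  have "0 \<le> \<delta>" using small[of 0] by simp
  have t: "t k \<le> 2 * \<delta> / \<Lambda> 0" if "k < length I" for k
    unfolding t_def
  proof (rule frac_le)
    show "\<bar>g (snd (I ! k)) - g (fst (I ! k))\<bar> \<le> 2 * \<delta>"
      using interval_seqs_nth[OF I that] small[of "fst (I ! k)"] small[of "snd (I ! k)"] by auto
    show "\<Lambda> 0 \<le> \<Lambda> k" using assms(1) by (simp add: mono_def)
  qed (use \<open>0 \<le> \<delta>\<close> pos in auto)
  have "sigma_sum \<Lambda> g I = (\<Sum>k\<in>{..<length I} \<inter> {..<m}. t k) + (\<Sum>k\<in>{..<length I} - {..<m}. t k)"
    unfolding sigma_sum_def t_def by (rule sum.Int_Diff) simp
  also have "(\<Sum>k\<in>{..<length I} - {..<m}. t k) = (\<Sum>k<length I - m. t (k + m))"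
    by (rule sum.reindex_bij_witness[of _ "\<lambda>k. k + m" "\<lambda>k. k - m"]) auto
  also have "\<dots> = sigma_sum (shift_seq m \<Lambda>) g (drop m I)"
    unfolding sigma_sum_def t_def shift_seq_def by (intro sum.cong) (auto simp: add.commute)
  also have "(\<Sum>k\<in>{..<length I} \<inter> {..<m}. t k) \<le>
      of_nat (card ({..<length I} \<inter> {..<m})) * (2 * \<delta> / \<Lambda> 0)"
    using t by (intro sum_bounded_above) auto
  also have "\<dots> \<le> real m * (2 * \<delta> / \<Lambda> 0)"
  proof (rule mult_right_mono)
    have "card ({..<length I} \<inter> {..<m}) \<le> card {..<m}" by (intro card_mono) auto
    then show "real (card ({..<length I} \<inter> {..<m})) \<le> real m" by simp
  qed (use \<open>0 \<le> \<delta>\<close> pos[of 0] in simp)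
  finally have "sigma_sum \<Lambda> g I \<le>
      2 * real m * \<delta> / \<Lambda> 0 + sigma_sum (shift_seq m \<Lambda>) g (drop m I)"
    by (simp add: algebra_simps)
  moreover have "0 \<le> sigma_sum (shift_seq m \<Lambda>) g (drop m I)"
    unfolding sigma_sum_def shift_seq_def using pos by (intro sum_nonneg) (simp add: less_imp_le)
  ultimately have "ennreal (sigma_sum \<Lambda> g I) \<le>
      ennreal (2 * real m * \<delta> / \<Lambda> 0) + ennreal (sigma_sum (shift_seq m \<Lambda>) g (drop m I))"
    using \<open>0 \<le> \<delta>\<close> pos[of 0] by (subst ennreal_plus[symmetric]) (auto intro: ennreal_leI simp del: ennreal_plus)
  also have "\<dots> \<le> ennreal (2 * real m * \<delta> / \<Lambda> 0) + Lambda_variation (shift_seq m \<Lambda>) g"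
    by (intro add_left_mono sigma_sum_le_variation drop_interval_seqs I)
  finally show "ennreal (sigma_sum \<Lambda> g I) \<le> \<dots>" .
qed

lemma shift_seq_mono_pos:
  assumes "mono \<Lambda>" "\<And>k. 0 < \<Lambda> k"
  shows "mono (shift_seq m \<Lambda>)" "0 < shift_seq m \<Lambda> k" "\<Lambda> k \<le> shift_seq m \<Lambda> k"
  using assms by (auto simp: mono_def shift_seq_def)

text \<open>The total variation, which is the \<open>\<Lambda>\<close>-variation for the constant sequence \<open>1\<close>, is
  finite for polynomials, and every weight of \<open>\<Lambda>\<^bsub>(m)\<^esub>\<close> is at most \<open>1 / \<Lambda> m\<close>.\<close>

lemma polynomial_tail_variation:
  assumes "proper_Lambda_sequence \<Lambda>" and p: "p \<in> polynomial_functions"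
  shows "(\<lambda>m. Lambda_variation (shift_seq m \<Lambda>) p) \<longlonglongrightarrow> 0"
proof -
  have mono: "mono \<Lambda>" and pos: "0 < \<Lambda> k" and lim: "filterlim \<Lambda> at_top sequentially" for k
    using assms(1) by (auto simp: proper_Lambda_sequence_def Lambda_sequence_def)
  have "Lambda_sequence (\<lambda>_. 1)"
    by (simp add: Lambda_sequence_def mono_def summable_const_iff)
  then have "p \<in> LambdaBV (\<lambda>_. 1)"
    using p polynomial_functions_subset_LambdaBV by blast
  then obtain W where W: "0 \<le> W" "Lambda_variation (\<lambda>_. 1) p = ennreal W"
    by (cases "Lambda_variation (\<lambda>_. 1) p") (auto simp: LambdaBV_def)
  have le: "Lambda_variation (shift_seq m \<Lambda>) p \<le> ennreal (W / \<Lambda> m)" for m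
    unfolding Lambda_variation_def
  proof (intro SUP_least ennreal_leI)
    fix I assume I: "I \<in> interval_seqs"
    have "sigma_sum (shift_seq m \<Lambda>) p I \<le> sigma_sum (\<lambda>_. 1) p I / \<Lambda> m"
      unfolding sigma_sum_def sum_divide_distrib shift_seq_def
      using pos by (intro sum_mono) (auto intro!: divide_left_mono mult_pos_pos monoD[OF mono])
    also have "sigma_sum (\<lambda>_. 1) p I \<le> W"
      using sigma_sum_le_variation[OF I, of "\<lambda>_. 1" p] W by simp
    finally show "sigma_sum (shift_seq m \<Lambda>) p I \<le> W / \<Lambda> m"
      using pos[of m] by (simp add: divide_right_mono less_imp_le)
  qed
  have "(\<lambda>m. ennreal (W / \<Lambda> m)) \<longlonglongrightarrow> ennreal 0"
    by (intro tendsto_ennrealI tendsto_divide_0[OF tendsto_const] filterlim_at_top_imp_at_infinity lim)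
  then have "(\<lambda>m. ennreal (W / \<Lambda> m)) \<longlonglongrightarrow> 0" by simp
  from tendsto_const this show ?thesis
    by (rule tendsto_sandwich[rotated 2]) (simp_all add: le)
qed

text \<open>The single interval from \<open>0\<close> to \<open>x\<close> already controls the value at \<open>x\<close>; in particular,
  convergence in \<open>\<Lambda>BV\<close> is uniform.\<close>

lemma abs_le_Lambda_dist:
  assumes "\<forall>k. 0 < \<Lambda> k" "f \<in> LambdaBV \<Lambda>" "g \<in> LambdaBV \<Lambda>" "x \<in> {0..1}"
  shows "\<bar>f x - g x\<bar> \<le> (1 + \<Lambda> 0) * Lambda_dist \<Lambda> f g"
proof -
  define V where "V = enn2real (Lambda_variation \<Lambda> (\<lambda>x. f x - g x))"
  have V: "Lambda_variation \<Lambda> (\<lambda>x. f x - g x) = ennreal V" "0 \<le> V"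
    using Lambda_variation_diff_finite[OF assms(1-3)] by (auto simp: V_def)
  have p: "0 < \<Lambda> 0" using assms(1) by simp
  have "\<bar>(f x - g x) - (f 0 - g 0)\<bar> \<le> \<Lambda> 0 * V"
  proof (cases "x = 0")
    case False
    then have "[(0, x)] \<in> interval_seqs"
      using assms(4) by (auto simp: interval_seqs_iff)
    from sigma_sum_le_variation[OF this, of \<Lambda> "\<lambda>x. f x - g x"]
    show ?thesis using p V by (simp add: sigma_sum_def field_simps)
  qed (use p V in simp)
  moreover have "Lambda_dist \<Lambda> f g = V + \<bar>f 0 - g 0\<bar>"
    by (simp add: Lambda_dist_alt V_def)
  moreover have "0 \<le> \<Lambda> 0 * \<bar>f 0 - g 0\<bar>" using p by simp
  ultimately show ?thesis using V(2) by (simp add: distrib_left distrib_right)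
qed

section \<open>The closure of the polynomials\<close>

lemma in_closure_of_polynomials_iff:
  assumes "Lambda_sequence \<Lambda>"
  shows "f \<in> LambdaBV_topology \<Lambda> closure_of polynomial_functions \<longleftrightarrow>
    f \<in> LambdaBV \<Lambda> \<and> (\<forall>\<epsilon>>0. \<exists>p\<in>polynomial_functions. Lambda_dist \<Lambda> f p < \<epsilon>)"
proof -
  interpret Metric_space "LambdaBV \<Lambda>" "Lambda_dist \<Lambda>"
    by (rule Metric_space_LambdaBV[OF assms])
  show ?thesis
    using polynomial_functions_subset_LambdaBV[OF assms]
    unfolding LambdaBV_topology_def metric_closure_of in_mball mem_Collect_eq by blast
qed

text \<open>Continuity is preserved by uniform limits. For the tail variations, split \<open>f\<close> into a
  polynomial \<open>q\<close> and \<open>f - q\<close>, whose tail variations are all at most its \<open>\<Lambda>\<close>-variation.\<close>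

lemma closure_subset_CLambdaBV_c:
  assumes \<Lambda>: "proper_Lambda_sequence \<Lambda>" and fB: "f \<in> LambdaBV \<Lambda>"
    and approx: "\<And>\<epsilon>. 0 < \<epsilon> \<Longrightarrow> \<exists>p\<in>polynomial_functions. Lambda_dist \<Lambda> f p < \<epsilon>"
  shows "f \<in> CLambdaBV_c \<Lambda>"
proof -
  have L: "Lambda_sequence \<Lambda>" and mono: "mono \<Lambda>" and pos: "0 < \<Lambda> k" for k
    using \<Lambda> by (auto simp: proper_Lambda_sequence_def Lambda_sequence_def)
  have "\<forall>n. \<exists>p\<in>polynomial_functions. Lambda_dist \<Lambda> f p < 1 / real (Suc n)"
    using approx by simp
  then obtain p where p: "\<And>n. p n \<in> polynomial_functions"
      "\<And>n. Lambda_dist \<Lambda> f (p n) < 1 / real (Suc n)"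
    by metis
  have pB: "p n \<in> LambdaBV \<Lambda>" for n
    using p(1) polynomial_functions_subset_LambdaBV[OF L] by blast
  have "continuous_on {0..1} f"
  proof (rule uniform_limit_theorem)
    show "\<forall>\<^sub>F n in sequentially. continuous_on {0..1} (p n)"
    proof (rule always_eventually, rule allI)
      fix n
      obtain q where "p n = restrict (poly q) {0..1}"
        using p(1) by (auto simp: polynomial_functions_def)
      moreover have "continuous_on {0..1} (poly q)"
        by (intro continuous_at_imp_continuous_on ballI poly_isCont)
      ultimately show "continuous_on {0..1} (p n)"
        by (metis continuous_on_cong restrict_apply')
    qed
    show "uniform_limit {0..1} p f sequentially"
    proof (rule uniform_limitI)
      fix e :: real assume "0 < e"
      have "(\<lambda>n. (1 + \<Lambda> 0) * (1 / real (Suc n))) \<longlonglongrightarrow> 0"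
        by (rule tendsto_mult_right_zero[OF LIMSEQ_Suc[OF lim_1_over_n]])
      then have "\<forall>\<^sub>F n in sequentially. (1 + \<Lambda> 0) * (1 / real (Suc n)) < e"
        using \<open>0 < e\<close> by (rule order_tendstoD)
      then show "\<forall>\<^sub>F n in sequentially. \<forall>x\<in>{0..1}. dist (p n x) (f x) < e"
      proof (rule eventually_mono, intro ballI)
        fix n and x :: real
        assume n: "(1 + \<Lambda> 0) * (1 / real (Suc n)) < e" and x: "x \<in> {0..1}"
        have "\<bar>f x - p n x\<bar> \<le> (1 + \<Lambda> 0) * Lambda_dist \<Lambda> f (p n)"
          using pos fB pB x by (intro abs_le_Lambda_dist) auto
        also have "\<dots> \<le> (1 + \<Lambda> 0) * (1 / real (Suc n))"
          using p(2)[of n] pos[of 0] by (intro mult_left_mono) auto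
        finally show "dist (p n x) (f x) < e" using n by (simp add: dist_real_def)
      qed
    qed
  qed simp
  moreover have "(\<lambda>m. Lambda_variation (shift_seq m \<Lambda>) f) \<longlonglongrightarrow> 0"
  proof (rule order_tendstoI)
    fix e :: ennreal assume "0 < e"
    then obtain c where c: "0 < c" "c < e" using dense by blast
    then obtain \<epsilon> where \<epsilon>: "0 < \<epsilon>" "ennreal (2 * \<epsilon>) < e"
      by (cases c) (auto intro: that[of "enn2real c / 2"])
    obtain q where q: "q \<in> polynomial_functions" "Lambda_dist \<Lambda> f q < \<epsilon>"
      using approx \<epsilon>(1) by blast
    then have qB: "q \<in> LambdaBV \<Lambda>"
      using polynomial_functions_subset_LambdaBV[OF L] by blast
    have "Lambda_variation \<Lambda> (\<lambda>x. f x - q x) =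
        ennreal (enn2real (Lambda_variation \<Lambda> (\<lambda>x. f x - q x)))"
      using Lambda_variation_diff_finite[OF _ fB qB] pos by simp
    also have "\<dots> \<le> ennreal \<epsilon>"
      using q(2) by (intro ennreal_leI) (simp add: Lambda_dist_alt)
    finally have fq: "Lambda_variation \<Lambda> (\<lambda>x. f x - q x) \<le> ennreal \<epsilon>" .
    have "\<forall>\<^sub>F m in sequentially. Lambda_variation (shift_seq m \<Lambda>) q < ennreal \<epsilon>"
      using polynomial_tail_variation[OF \<Lambda> q(1)] \<epsilon>(1) by (intro order_tendstoD) auto
    then show "\<forall>\<^sub>F m in sequentially. Lambda_variation (shift_seq m \<Lambda>) f < e"
    proof (rule eventually_mono)
      fix m assume m: "Lambda_variation (shift_seq m \<Lambda>) q < ennreal \<epsilon>"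
      have "Lambda_variation (shift_seq m \<Lambda>) f \<le>
          Lambda_variation (shift_seq m \<Lambda>) (\<lambda>x. f x - q x) + Lambda_variation (shift_seq m \<Lambda>) q"
        using shift_seq_mono_pos[OF mono pos] by (intro Lambda_variation_add_le) auto
      also have "\<dots> \<le> ennreal \<epsilon> + ennreal \<epsilon>"
      proof (rule add_mono)
        have "Lambda_variation (shift_seq m \<Lambda>) (\<lambda>x. f x - q x) \<le>
            Lambda_variation \<Lambda> (\<lambda>x. f x - q x)"
          using pos shift_seq_mono_pos(3)[OF mono pos] by (rule Lambda_variation_antimono)
        then show "Lambda_variation (shift_seq m \<Lambda>) (\<lambda>x. f x - q x) \<le> ennreal \<epsilon>"
          using fq by (rule order_trans)
      qed (use m in simp)
      also have "\<dots> = ennreal (2 * \<epsilon>)"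
        using \<epsilon>(1) by (simp flip: ennreal_plus)
      finally show "Lambda_variation (shift_seq m \<Lambda>) f < e" using \<epsilon>(2) by simp
    qed
  qed simp
  ultimately show ?thesis
    using fB by (simp add: CLambdaBV_c_def continuous_in_Lambda_variation_def LambdaBV_def)
qed

text \<open>The order of choices matters: \<open>m\<close> depends only on \<open>f\<close>, because the tail variation of
  the Bernstein polynomials is bounded by that of \<open>f\<close> for all degrees at once; the
  degree \<open>n\<close> is then chosen in terms of \<open>m\<close>.\<close>

lemma CLambdaBV_c_approx:
  assumes L: "Lambda_sequence \<Lambda>" and f: "f \<in> CLambdaBV_c \<Lambda>" and "0 < \<epsilon>"
  shows "\<exists>p\<in>polynomial_functions. Lambda_dist \<Lambda> f p < \<epsilon>"
proof -
  have mono: "mono \<Lambda>" and pos: "0 < \<Lambda> k" for k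
    using L by (auto simp: Lambda_sequence_def)
  note shift = shift_seq_mono_pos[OF mono pos]
  have cont: "continuous_on {0..1} f"
    and tail: "(\<lambda>m. Lambda_variation (shift_seq m \<Lambda>) f) \<longlonglongrightarrow> 0"
    using f by (auto simp: CLambdaBV_c_def continuous_in_Lambda_variation_def)
  have "\<forall>\<^sub>F m in sequentially. Lambda_variation (shift_seq m \<Lambda>) f < ennreal (\<epsilon> / 8)"
    using order_tendstoD(2)[OF tail] \<open>0 < \<epsilon>\<close> by simp
  then obtain m where m: "Lambda_variation (shift_seq m \<Lambda>) f < ennreal (\<epsilon> / 8)"
    by (auto simp: eventually_sequentially)
  \<comment> \<open>The second bound makes the first \<open>m\<close> terms contribute at most \<open>\<epsilon> / 4\<close>, like the tail; the
    first bounds the remaining summand \<open>\<bar>f 0 - p 0\<bar>\<close> of the norm. The denominator has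
    \<open>m + 1\<close> because \<open>m\<close> may be \<open>0\<close>.\<close>
  define \<delta> where "\<delta> = min (\<epsilon> / 4) (\<epsilon> * \<Lambda> 0 / (8 * (real m + 1)))"
  have "0 < \<delta>" using \<open>0 < \<epsilon>\<close> pos[of 0] by (simp add: \<delta>_def)
  from Bernstein_Weierstrass[OF cont this] obtain N where
    N: "\<And>n x. N \<le> n \<Longrightarrow> x \<in> {0..1} \<Longrightarrow> \<bar>f x - Bernstein_approx n f x\<bar> < \<delta>"
    unfolding Bernstein_approx_def by blast
  \<comment> \<open>A positive degree, since the nodes \<open>j / n\<close> degenerate for \<open>n = 0\<close>.\<close>
  define n where "n = Suc N"
  define g where "g x = f x - Bernstein_approx n f x" for x
  have g: "\<bar>g x\<bar> \<le> \<delta>" if "x \<in> {0..1}" for x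
    using N[of n x] that by (simp add: g_def n_def less_imp_le)
  have "Lambda_variation (shift_seq m \<Lambda>) g \<le> Lambda_variation (shift_seq m \<Lambda>) f +
      Lambda_variation (shift_seq m \<Lambda>) (\<lambda>x. - Bernstein_approx n f x)"
    using shift by (intro Lambda_variation_add_le) (auto simp: g_def)
  also have "\<dots> \<le> ennreal (\<epsilon> / 8) + ennreal (\<epsilon> / 8)"
    unfolding Lambda_variation_uminus
    using m Lambda_variation_Bernstein_le[OF shift(1)[of m] shift(2)[of m], of n f] unfolding n_def
    by (intro add_mono) auto
  also have "\<dots> = ennreal (\<epsilon> / 4)"
    using \<open>0 < \<epsilon>\<close> by (simp flip: ennreal_plus)
  finally have "Lambda_variation \<Lambda> g \<le> ennreal (2 * real m * \<delta> / \<Lambda> 0) + ennreal (\<epsilon> / 4)"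
    using Lambda_variation_le_split[OF mono pos g, where m = m] by (meson add_left_mono order_trans)
  also have "\<dots> \<le> ennreal (\<epsilon> / 4) + ennreal (\<epsilon> / 4)"
  proof (intro add_right_mono ennreal_leI)
    have "\<delta> * (8 * (real m + 1)) \<le> \<epsilon> * \<Lambda> 0"
      by (simp add: \<delta>_def flip: pos_le_divide_eq)
    moreover have "2 * real m * \<delta> * 4 \<le> \<delta> * (8 * (real m + 1))"
      using \<open>0 < \<delta>\<close> by (simp add: algebra_simps)
    ultimately have "2 * real m * \<delta> * 4 \<le> \<epsilon> * \<Lambda> 0" by linarith
    then show "2 * real m * \<delta> / \<Lambda> 0 \<le> \<epsilon> / 4"
      using pos[of 0] by (simp add: field_simps)
  qed
  also have "\<dots> = ennreal (\<epsilon> / 2)"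
    using \<open>0 < \<epsilon>\<close> by (simp flip: ennreal_plus)
  finally have "enn2real (Lambda_variation \<Lambda> g) \<le> \<epsilon> / 2"
    using \<open>0 < \<epsilon>\<close> by (intro enn2real_leI) auto
  define p where "p = restrict (Bernstein_approx n f) {0..1}"
  have "Lambda_variation \<Lambda> (\<lambda>x. f x - p x) = Lambda_variation \<Lambda> g"
    by (rule Lambda_variation_cong) (simp add: p_def g_def)
  then have "Lambda_dist \<Lambda> f p = enn2real (Lambda_variation \<Lambda> g) + \<bar>g 0\<bar>"
    by (simp add: Lambda_dist_alt p_def g_def)
  also have "\<dots> \<le> \<epsilon> / 2 + \<epsilon> / 4"
    using g[of 0] \<open>enn2real _ \<le> _\<close> by (intro add_mono) (auto simp: \<delta>_def)
  also have "\<dots> < \<epsilon>" using \<open>0 < \<epsilon>\<close> by simp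
  finally show ?thesis using Bernstein_approx_polynomial by (auto simp: p_def)
qed

theorem corollary1:
  fixes \<Lambda> :: "nat \<Rightarrow> real"
  assumes "proper_Lambda_sequence \<Lambda>"
  shows "CLambdaBV_c \<Lambda> = LambdaBV_topology \<Lambda> closure_of polynomial_functions"
proof -
  have L: "Lambda_sequence \<Lambda>" using assms by (simp add: proper_Lambda_sequence_def)
  have "CLambdaBV_c \<Lambda> \<subseteq> LambdaBV \<Lambda>"
    by (auto simp: CLambdaBV_c_def continuous_in_Lambda_variation_def)
  then show ?thesis
    using closure_subset_CLambdaBV_c[OF assms] CLambdaBV_c_approx[OF L]
    by (auto simp: in_closure_of_polynomials_iff[OF L])
qed

end
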